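(* Let $\lambda$ be a real number with $\lambda>-1$, $\lambda\neq0$, and let $x$ be a real number. For every integer $n\ge1$, \[ \mathrm{Bel}_{n,\lambda}(x)=\frac{\log(1+\lambda)}{\lambda}\,x\sum_{k=1}^{n}\sum_{j=1}^{k}S_{1}(n,k)\,\lambda^{n-k}\binom{k-1}{j-1}\mathrm{Bel}_{j-1}\!\left(x\,\frac{\log(1+\lambda)}{\lambda}\right). \]
   Context: The degenerate Bell polynomials $\mathrm{Bel}_{n,\lambda}(x)$ are defined by \[ (1+\lambda)^{\frac{x}{\lambda}\left((1+\lambda t)^{1/\lambda}-1\right)}=\exp\!\Big(\tfrac{x}{\lambda}\log(1+\lambda)\big((1+\lambda t)^{1/\lambda}-1\big)\Big)=\sum_{n=0}^{\infty}\mathrm{Bel}_{n,\lambda}(x)\frac{t^{n}}{n!}, \] with $(1+\lambda t)^{1/\lambda}=\exp(\tfrac1\lambda\log(1+\lambda t))$. The (ordinary) Bell polynomials $\mathrm{Bel}_n(x)$ are defined by $e^{x(e^t-1)}=\sum_{n\ge0}\mathrm{Bel}_n(x)\frac{t^n}{n!}$. $S_1(n,k)$ are the (signed) Stirling numbers of the first kind, defined by $x(x-1)\cdots(x-n+1)=\sum_{k=0}^{n}S_1(n,k)x^k$. (The paper writes the argument $x\frac{\log(1+\lambda)}{\lambda}$ as $x\log(1+\lambda)^{1/\lambda}$, meaning $x\log\big((1+\lambda)^{1/\lambda}\big)$.) *)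

theory Defs
  imports "HOL-Complex_Analysis.Complex_Analysis"
begin

definition has_egf :: "(nat \<Rightarrow> real) \<Rightarrow> (real \<Rightarrow> real) \<Rightarrow> bool" where
  "has_egf a f \<longleftrightarrow> (\<forall>\<^sub>F t in nhds 0. (\<lambda>n. a n * (t ^ n / fact n)) sums f t)"

definition degenerate_bell :: "nat \<Rightarrow> real \<Rightarrow> real \<Rightarrow> real" where
  "degenerate_bell n lam x =
     (THE a. has_egf a (\<lambda>t. (1 + lam) powr (x / lam * ((1 + lam * t) powr (1 / lam) - 1)))) n"

definition bell :: "nat \<Rightarrow> real \<Rightarrow> real" where
  "bell n x = (THE a. has_egf a (\<lambda>t. exp (x * (exp t - 1)))) n"

definition S1 :: "nat \<Rightarrow> nat \<Rightarrow> int" where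
  "S1 n k = coeff (\<Prod>i<n. [:- int i, 1:]) k"

text \<open>Both generating functions are analytic at 0, so the definite descriptions above are
  proper; the power series of the degenerate one in general has a finite radius of convergence, which is why
  \<open>has_egf\<close> only asks for a neighbourhood of 0.\<close>

lemma has_egf_unique:
  assumes "has_egf a f" "has_egf b f"
  shows "a = b"
proof -
  define c where "c n = (a n - b n) / fact n" for n
  have "\<forall>\<^sub>F t in nhds 0. (\<lambda>n. c n * t ^ n) sums 0"
    using assms unfolding has_egf_def
  proof eventually_elim
    case (elim t)
    have "a n * (t ^ n / fact n) - b n * (t ^ n / fact n) = c n * t ^ n" for n
      by (simp add: c_def left_diff_distrib diff_divide_distrib)
    with sums_diff[OF elim] show ?case by simp
  qed
  then obtain d where d: "d > 0" "\<And>t. dist t 0 < d \<Longrightarrow> (\<lambda>n. c n * t ^ n) sums 0"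
    unfolding eventually_nhds_metric by blast
  have c0: "c 0 = 0"
    using d(2)[of 0] d(1) by simp
  have "c m = 0" for m
  proof (rule ccontr)
    assume m: "c m \<noteq> 0"
    with c0 have "m > 0" by (cases m) auto
    obtain s where s: "0 < s" "\<And>z::real. z \<in> cball 0 s - {0} \<Longrightarrow> (0::real) \<noteq> 0"
      by (rule powser_0_nonzero[where r = d and a = c and \<xi> = 0 and f = "\<lambda>_. 0" and m = m])
        (use d m \<open>m > 0\<close> in \<open>auto simp: dist_norm\<close>)
    from s(2)[of s] s(1) show False by simp
  qed
  then show ?thesis
    by (intro ext) (simp add: c_def)
qed

lemma has_egf_The: "has_egf a f \<Longrightarrow> has_egf (THE a. has_egf a f) f"
  by (rule theI[where P = "\<lambda>a. has_egf a f"]) (assumption, erule has_egf_unique)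

lemma has_egf_holomorphic:
  assumes "r > 0" "F holomorphic_on ball 0 r"
    and "\<And>t. \<bar>t\<bar> < r \<Longrightarrow> F (complex_of_real t) = complex_of_real (f t)"
  shows "has_egf (\<lambda>n. Re ((deriv ^^ n) F 0)) f"
proof -
  have "(\<lambda>n. Re ((deriv ^^ n) F 0) * (t ^ n / fact n)) sums f t" if "\<bar>t\<bar> < r" for t
  proof -
    have "(\<lambda>n. (deriv ^^ n) F 0 / fact n * (of_real t - 0) ^ n) sums F (of_real t)"
      by (rule holomorphic_power_series[OF assms(2)]) (use that in auto)
    from sums_Re[OF this]
    have "(\<lambda>n. Re ((deriv ^^ n) F 0 / fact n * of_real t ^ n)) sums f t"
      using assms(3)[OF that] by simp
    moreover have "Re ((deriv ^^ n) F 0 / fact n * of_real t ^ n)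
        = Re ((deriv ^^ n) F 0) * (t ^ n / fact n)" for n
    proof -
      have *: "(deriv ^^ n) F 0 / fact n * of_real t ^ n
          = (deriv ^^ n) F 0 * complex_of_real (t ^ n / fact n)"
        by simp
      show ?thesis unfolding * by (simp only: times_complex.sel Re_complex_of_real Im_complex_of_real mult_zero_right diff_zero)
    qed
    ultimately show ?thesis by simp
  qed
  then show ?thesis
    unfolding has_egf_def eventually_nhds_metric
    using assms(1) by (auto simp: dist_norm)
qed

lemma has_egf_bell: "has_egf (\<lambda>n. bell n x) (\<lambda>t. exp (x * (exp t - 1)))"
proof -
  have "has_egf (\<lambda>n. Re ((deriv ^^ n) (\<lambda>z. exp (of_real x * (exp z - 1))) 0))
          (\<lambda>t. exp (x * (exp t - 1)))"
    by (rule has_egf_holomorphic[of 1])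
      (auto intro!: holomorphic_intros simp flip: exp_of_real)
  then show ?thesis
    unfolding bell_def by (rule has_egf_The)
qed

lemma has_egf_degenerate_bell:
  assumes "lam > -1" "lam \<noteq> 0"
  shows "has_egf (\<lambda>n. degenerate_bell n lam x)
    (\<lambda>t. (1 + lam) powr (x / lam * ((1 + lam * t) powr (1 / lam) - 1)))"
proof -
  let ?f = "\<lambda>t. (1 + lam) powr (x / lam * ((1 + lam * t) powr (1 / lam) - 1))"
  let ?F = "\<lambda>z. exp (of_real (x / lam) * (exp (of_real (1 / lam) * Ln (1 + of_real lam * z)) - 1) * of_real (ln (1 + lam)))"
  have pos: "Re (1 + of_real lam * z) > 0" if "norm z < 1 / \<bar>lam\<bar>" for z
  proof -
    have "\<bar>lam * Re z\<bar> \<le> \<bar>lam\<bar> * norm z"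
      by (simp add: abs_mult mult_left_mono abs_Re_le_cmod)
    also have "\<dots> < 1"
      using that assms by (simp add: field_simps)
    finally show ?thesis by simp
  qed
  have "has_egf (\<lambda>n. Re ((deriv ^^ n) ?F 0)) ?f"
  proof (rule has_egf_holomorphic[of "1 / \<bar>lam\<bar>"])
    show "?F holomorphic_on ball 0 (1 / \<bar>lam\<bar>)"
      using pos by (intro holomorphic_intros) (auto simp: complex_nonpos_Reals_iff not_le)
  next
    fix t :: real
    assume t: "\<bar>t\<bar> < 1 / \<bar>lam\<bar>"
    from pos[of "of_real t"] t have p: "1 + lam * t > 0" by simp
    then have "Ln (1 + of_real lam * of_real t) = complex_of_real (ln (1 + lam * t))"
      using Ln_of_real[OF p] by simp
    then show "?F (complex_of_real t) = complex_of_real (?f t)"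
      using p assms by (simp add: powr_def mult_ac flip: exp_of_real)
  qed (use assms in auto)
  then show ?thesis
    unfolding degenerate_bell_def by (rule has_egf_The)
qed

end

theory Submission
  imports Defs
begin

text \<open>
  Put \<open>c = x ln (1 + \<lambda>) / \<lambda>\<close>. Near 0, the degenerate generating function is \<open>f (ln (1 + \<lambda> t) / \<lambda>)\<close>, where
  \<open>f u = exp (c (exp u - 1))\<close> generates the Bell polynomials at \<open>c\<close>. The \<open>n\<close>-th derivative of such a composite
  is \<open>(1 + \<lambda> t) ^ (- n)\<close> times a linear combination of the derivatives of \<open>f\<close> whose coefficients satisfy
  the recurrence of \<open>S1 n k * \<lambda> ^ (n - k)\<close>. At \<open>t = 0\<close> this expresses the degenerate Bell polynomials
  through \<open>bell k c\<close>, and \<open>f' u = c exp u * f u\<close> turns \<open>bell k c\<close> into a binomial convolution.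
\<close>

section \<open>Stirling numbers of the first kind\<close>

lemma S1_Suc_0: "S1 (Suc n) 0 = - int n * S1 n 0"
  by (simp add: S1_def coeff_mult)

lemma S1_Suc_Suc: "S1 (Suc n) (Suc k) = S1 n k - int n * S1 n (Suc k)"
  by (simp add: S1_def mult.commute[of _ "[:_, _:]"])

lemma S1_0_right: "n > 0 \<Longrightarrow> S1 n 0 = 0"
proof (induction n)
  case (Suc n)
  then show ?case by (cases n) (simp_all add: S1_Suc_0)
qed simp

lemma S1_eq_0: "n < k \<Longrightarrow> S1 n k = 0"
proof (induction n arbitrary: k)
  case 0
  then show ?case by (simp add: S1_def)
next
  case (Suc n)
  then show ?case by (cases k) (simp_all add: S1_Suc_Suc)
qed

text \<open>This matches the quotient rule: the first sum will come from the chain rule, the second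
  from the denominator \<open>(1 + l * t) ^ n\<close>. Its factor \<open>l\<close> arises from
  \<open>Suc n - k = Suc (n - k)\<close> for \<open>k \<le> n\<close>.\<close>

lemma sum_S1_Suc:
  fixes l :: real
  shows "(\<Sum>k\<le>Suc n. of_int (S1 (Suc n) k) * l ^ (Suc n - k) * X k) =
    (\<Sum>k\<le>n. of_int (S1 n k) * l ^ (n - k) * X (Suc k))
    - of_nat n * l * (\<Sum>k\<le>n. of_int (S1 n k) * l ^ (n - k) * X k)"
proof -
  \<comment> \<open>Appending the zero term at \<open>k = Suc n\<close> allows splitting off
    \<open>k = 0\<close>, which gives the shifted sum produced by \<open>S1_Suc_Suc\<close>.\<close>
  have "(\<Sum>k\<le>Suc n. of_int (S1 n k) * l ^ (Suc n - k) * X k)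
      = (\<Sum>k\<le>n. of_int (S1 n k) * l ^ (Suc n - k) * X k)"
    by (simp add: S1_eq_0)
  also have "\<dots> = l * (\<Sum>k\<le>n. of_int (S1 n k) * l ^ (n - k) * X k)"
    by (simp add: sum_distrib_left Suc_diff_le mult_ac)
  finally have *: "of_int (S1 n 0) * l ^ Suc n * X 0
      + (\<Sum>k\<le>n. of_int (S1 n (Suc k)) * l ^ (n - k) * X (Suc k))
      = l * (\<Sum>k\<le>n. of_int (S1 n k) * l ^ (n - k) * X k)"
    by (simp only: sum.atMost_Suc_shift diff_zero diff_Suc_Suc)
  have "(\<Sum>k\<le>Suc n. of_int (S1 (Suc n) k) * l ^ (Suc n - k) * X k) =
    (\<Sum>k\<le>n. of_int (S1 n k) * l ^ (n - k) * X (Suc k))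
    - of_nat n * (of_int (S1 n 0) * l ^ Suc n * X 0
      + (\<Sum>k\<le>n. of_int (S1 n (Suc k)) * l ^ (n - k) * X (Suc k)))"
    by (simp only: sum.atMost_Suc_shift diff_zero diff_Suc_Suc S1_Suc_0 S1_Suc_Suc)
      (simp add: algebra_simps sum_subtractf sum_distrib_left)
  then show ?thesis
    unfolding * by (simp only: mult.assoc)
qed

section \<open>Calculus of exponential generating functions near 0\<close>

lemma has_egf_cong:
  assumes "\<forall>\<^sub>F t in nhds 0. f t = g t"
  shows "has_egf a f \<longleftrightarrow> has_egf a g"
  unfolding has_egf_def by (rule eventually_subst) (use assms in eventually_elim, simp)

lemma has_egf_at_0:
  assumes "has_egf a f"
  shows "f 0 = a 0"
proof -
  have "(\<lambda>n. a n / fact n * 0 ^ n) sums f 0"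
    using eventually_nhds_x_imp_x[OF assms[unfolded has_egf_def]] by simp
  then show ?thesis
    using powser_sums_zero[of "\<lambda>n. a n / fact n"] by (simp add: sums_iff)
qed

text \<open>A power series converges absolutely strictly inside any radius of convergence; Cauchy
  products rely on this.\<close>

lemma has_egf_radius:
  assumes "has_egf a f"
  obtains r where "r > 0" "\<And>t. \<bar>t\<bar> < r \<Longrightarrow> (\<lambda>n. a n / fact n * t ^ n) sums f t"
    "\<And>t. \<bar>t\<bar> < r \<Longrightarrow> summable (\<lambda>n. norm (a n / fact n * t ^ n))"
proof -
  from assms obtain r where r: "r > 0" "\<And>t. \<bar>t\<bar> < r \<Longrightarrow> (\<lambda>n. a n / fact n * t ^ n) sums f t"
    unfolding has_egf_def eventually_nhds_metric by (auto simp: dist_norm)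
  have "summable (\<lambda>n. norm (a n / fact n * t ^ n))" if t: "\<bar>t\<bar> < r" for t
  proof -
    obtain s where s: "\<bar>t\<bar> < s" "s < r"
      using t dense by blast
    then have "\<bar>s\<bar> < r" by linarith
    from sums_summable[OF r(2)[OF this]] show ?thesis
      by (rule powser_insidea) (use s in auto)
  qed
  with r that show ?thesis by blast
qed

text \<open>Termwise differentiation: the factor \<open>Suc n\<close> cancels against the factorial,
  leaving a shift of the coefficients.\<close>

lemma has_egf_deriv:
  assumes "has_egf a f"
  shows "\<forall>\<^sub>F t in nhds 0. (f has_real_derivative deriv f t) (at t)"
    and "has_egf (\<lambda>n. a (Suc n)) (deriv f)"
proof -
  obtain r where r: "r > 0" "\<And>t. \<bar>t\<bar> < r \<Longrightarrow> (\<lambda>n. a n / fact n * t ^ n) sums f t"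
    by (rule has_egf_radius[OF assms]) blast
  have D: "(f has_real_derivative (\<Sum>n. a (Suc n) / fact n * t ^ n)) (at t)"
    and S: "summable (\<lambda>n. a (Suc n) / fact n * t ^ n)" if t: "\<bar>t\<bar> < r" for t
  proof -
    have diffs: "diffs (\<lambda>n. a n / fact n) n = a (Suc n) / fact n" for n
      by (simp add: diffs_def divide_simps del: of_nat_Suc)
    \<comment> \<open>Termwise differentiation at \<open>t\<close> needs convergence at a point of
      larger modulus.\<close>
    obtain s where s: "\<bar>t\<bar> < s" "s < r"
      using t dense by blast
    have "summable (\<lambda>n. a n / fact n * s ^ n)"
      using r(2)[of s] s by (auto dest: sums_summable)
    then have "((\<lambda>t. \<Sum>n. a n / fact n * t ^ n) has_real_derivative
        (\<Sum>n. a (Suc n) / fact n * t ^ n)) (at t)"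
      unfolding diffs[symmetric] by (rule termdiffs_strong) (use s in auto)
    moreover have "(\<Sum>n. a n / fact n * u ^ n) = f u" if "u \<in> ball 0 r" for u
      by (rule sums_unique[symmetric], rule r(2)) (use that in simp)
    ultimately show "(f has_real_derivative (\<Sum>n. a (Suc n) / fact n * t ^ n)) (at t)"
      using t by (elim has_field_derivative_transform_within_open[where S = "ball 0 r"]) auto
    show "summable (\<lambda>n. a (Suc n) / fact n * t ^ n)"
      unfolding diffs[symmetric]
      by (rule termdiff_converges[of _ r]) (use t in simp, rule sums_summable, rule r(2), simp)
  qed
  have near: "\<forall>\<^sub>F t in nhds 0. \<bar>t\<bar> < r"
    using r(1) by (auto simp: eventually_nhds_metric dist_norm)
  then show "\<forall>\<^sub>F t in nhds 0. (f has_real_derivative deriv f t) (at t)"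
    by eventually_elim (use D DERIV_imp_deriv[OF D] in simp)
  from near show "has_egf (\<lambda>n. a (Suc n)) (deriv f)"
    unfolding has_egf_def
    by eventually_elim (use S DERIV_imp_deriv[OF D] in \<open>simp add: sums_iff\<close>)
qed

lemma has_egf_derivative:
  assumes "has_egf a f" and "\<forall>\<^sub>F t in nhds 0. (f has_real_derivative f' t) (at t)"
  shows "has_egf (\<lambda>n. a (Suc n)) f'"
proof -
  have "\<forall>\<^sub>F t in nhds 0. deriv f t = f' t"
    using assms(2) by eventually_elim (rule DERIV_imp_deriv)
  from has_egf_cong[OF this] show ?thesis
    using has_egf_deriv(2)[OF assms(1)] by blast
qed

lemma has_egf_deriv_funpow:
  assumes "has_egf a f"
  shows "has_egf (\<lambda>n. a (n + k)) ((deriv ^^ k) f)"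
proof (induction k)
  case (Suc k)
  from has_egf_deriv(2)[OF this] show ?case by simp
qed (use assms in simp)

lemma has_egf_cmult: "has_egf a f \<Longrightarrow> has_egf (\<lambda>n. c * a n) (\<lambda>t. c * f t)"
  unfolding has_egf_def by (erule eventually_mono) (auto simp: mult.assoc dest: sums_mult)

lemma has_egf_exp: "has_egf (\<lambda>_. 1) exp"
  using exp_converges[where 'a = real] by (simp add: has_egf_def field_simps)

lemma has_egf_mult:
  assumes "has_egf a f" "has_egf b g"
  shows "has_egf (\<lambda>n. \<Sum>k\<le>n. of_nat (n choose k) * a k * b (n - k)) (\<lambda>t. f t * g t)"
proof -
  obtain r where r: "r > 0" "\<And>t. \<bar>t\<bar> < r \<Longrightarrow> (\<lambda>n. a n / fact n * t ^ n) sums f t"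
    "\<And>t. \<bar>t\<bar> < r \<Longrightarrow> summable (\<lambda>n. norm (a n / fact n * t ^ n))"
    by (rule has_egf_radius[OF assms(1)]) blast
  obtain s where s: "s > 0" "\<And>t. \<bar>t\<bar> < s \<Longrightarrow> (\<lambda>n. b n / fact n * t ^ n) sums g t"
    "\<And>t. \<bar>t\<bar> < s \<Longrightarrow> summable (\<lambda>n. norm (b n / fact n * t ^ n))"
    by (rule has_egf_radius[OF assms(2)]) blast
  have "(\<lambda>n. (\<Sum>k\<le>n. of_nat (n choose k) * a k * b (n - k)) * (t ^ n / fact n)) sums (f t * g t)"
    if t: "\<bar>t\<bar> < min r s" for t
  proof -
    have "(\<lambda>n. \<Sum>k\<le>n. a k / fact k * t ^ k * (b (n - k) / fact (n - k) * t ^ (n - k)))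
        sums ((\<Sum>n. a n / fact n * t ^ n) * (\<Sum>n. b n / fact n * t ^ n))"
      using r(3) s(3) t by (intro Cauchy_product_sums) auto
    moreover have "(\<Sum>k\<le>n. a k / fact k * t ^ k * (b (n - k) / fact (n - k) * t ^ (n - k)))
        = (\<Sum>k\<le>n. of_nat (n choose k) * a k * b (n - k)) * (t ^ n / fact n)" for n
      unfolding sum_distrib_right
    proof (rule sum.cong)
      fix k assume "k \<in> {..n}"
      then have "k \<le> n" by simp
      then have "t ^ n = t ^ k * t ^ (n - k)"
        by (simp flip: power_add)
      with \<open>k \<le> n\<close> show "a k / fact k * t ^ k * (b (n - k) / fact (n - k) * t ^ (n - k))
          = of_nat (n choose k) * a k * b (n - k) * (t ^ n / fact n)"
        by (simp add: binomial_fact)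
    qed simp
    ultimately show ?thesis
      using r(2)[of t] s(2)[of t] t by (simp add: sums_iff)
  qed
  moreover have "\<forall>\<^sub>F t in nhds 0. \<bar>t\<bar> < min r s"
    using r(1) s(1) by (auto simp: eventually_nhds_metric dist_norm intro!: exI[of _ "min r s"])
  ultimately show ?thesis
    unfolding has_egf_def by (auto elim: eventually_mono)
qed

section \<open>Composition with a scaled logarithm\<close>

lemma has_egf_compose_ln:
  fixes l :: real
  assumes f: "has_egf a f" and g: "has_egf b (\<lambda>t. f (ln (1 + l * t) / l))" and l: "l \<noteq> 0"
  shows "b n = (\<Sum>k\<le>n. of_int (S1 n k) * l ^ (n - k) * a k)"
proof -
  define u where "u t = ln (1 + l * t) / l" for t
  \<comment> \<open>\<open>G n\<close> is the expected n-th derivative of the composite near 0; each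
    chain rule step contributes \<open>u' = 1 / (1 + l * t)\<close>.\<close>
  define G where
    "G n t = (\<Sum>k\<le>n. of_int (S1 n k) * l ^ (n - k) * (deriv ^^ k) f (u t)) / (1 + l * t) ^ n" for n t
  have pos: "\<forall>\<^sub>F t in nhds 0. 1 + l * t > 0"
    by (rule order_tendstoD[of _ 1]) (auto intro!: tendsto_eq_intros filterlim_ident)
  \<comment> \<open>Facts about \<open>f\<close> near 0 thereby hold at \<open>u t\<close> for all
    \<open>t\<close> near 0.\<close>
  have "(u \<longlongrightarrow> 0) (nhds 0)"
    unfolding u_def by (auto intro!: tendsto_eq_intros filterlim_ident simp: l)
  then have lim: "filterlim u (nhds 0) (nhds 0)" .
  have "has_egf (\<lambda>m. b (m + n)) (G n)"
  proof (induction n)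
    case 0
    then show ?case using g by (simp add: G_def u_def S1_def)
  next
    case (Suc n)
    \<comment> \<open>Each order \<open>k\<close> comes with its own neighbourhood; finitely many of
      them can be intersected.\<close>
    have "\<forall>\<^sub>F t in nhds 0. \<forall>k\<in>{..n}.
        ((deriv ^^ k) f has_real_derivative (deriv ^^ Suc k) f (u t)) (at (u t))"
      unfolding eventually_ball_finite_distrib[OF finite_atMost]
      using has_egf_deriv(1)[OF has_egf_deriv_funpow[OF f]] lim
      by (auto simp: filterlim_iff)
    with pos have "\<forall>\<^sub>F t in nhds 0. (G n has_real_derivative G (Suc n) t) (at t)"
    proof eventually_elim
      case (elim t)
      let ?c = "\<lambda>k. of_int (S1 n k) * l ^ (n - k)"
      let ?p = "1 + l * t"
      have u: "(u has_real_derivative 1 / ?p) (at t)"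
        unfolding u_def using elim(1) l by (auto intro!: derivative_eq_intros)
      have D: "((\<lambda>t. \<Sum>k\<le>n. ?c k * (deriv ^^ k) f (u t)) has_real_derivative
          (\<Sum>k\<le>n. ?c k * ((deriv ^^ Suc k) f (u t) * (1 / ?p)))) (at t)"
        by (intro DERIV_sum DERIV_cmult DERIV_chain2[OF _ u]) (use elim(2) in auto)
      \<comment> \<open>Writing \<open>?p ^ n / ?p\<close> instead of a power with exponent
        \<open>n - 1\<close> treats \<open>n = 0\<close> uniformly.\<close>
      have P: "((\<lambda>t. (1 + l * t) ^ n) has_real_derivative of_nat n * l * ?p ^ n / ?p) (at t)"
      proof (rule DERIV_cong)
        have "((\<lambda>t. 1 + l * t) has_real_derivative l) (at t)"
          by (auto intro!: derivative_eq_intros)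
        then show "((\<lambda>t. (1 + l * t) ^ n) has_real_derivative of_nat n * (l * ?p ^ (n - Suc 0))) (at t)"
          by (rule DERIV_power)
        show "of_nat n * (l * ?p ^ (n - Suc 0)) = of_nat n * l * ?p ^ n / ?p"
          using elim(1) by (cases n) simp_all
      qed
      have "((\<lambda>t. G n t) has_real_derivative
          ((\<Sum>k\<le>n. ?c k * ((deriv ^^ Suc k) f (u t) * (1 / ?p))) * ?p ^ n
            - (\<Sum>k\<le>n. ?c k * (deriv ^^ k) f (u t)) * (of_nat n * l * ?p ^ n / ?p))
          / (?p ^ n * ?p ^ n)) (at t)"
        unfolding G_def by (rule DERIV_divide[OF D P]) (use elim(1) in simp)
      moreover have "(\<Sum>k\<le>n. ?c k * ((deriv ^^ Suc k) f (u t) * (1 / ?p)))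
          = (\<Sum>k\<le>n. ?c k * (deriv ^^ Suc k) f (u t)) / ?p"
        by (simp add: sum_divide_distrib)
      \<comment> \<open>With \<open>P = p ^ n\<close>, the quotient rule yields the numerator of
        \<open>sum_S1_Suc\<close> over \<open>p ^ Suc n\<close>.\<close>
      moreover have "(A / p * P - B * (of_nat n * l * P / p)) / (P * P)
          = (A - of_nat n * l * B) / (p * P)" if "p > 0" "P > 0" for A B p P :: real
        using that by (simp add: divide_simps) (simp add: algebra_simps)
      ultimately show ?case
        using elim(1)
        by (simp only: G_def[of "Suc n"] sum_S1_Suc power_Suc zero_less_power)
    qed
    from has_egf_derivative[OF Suc this] show ?case by simp
  qed
  from has_egf_at_0[OF this] have "b n = G n 0" by simp
  also have "\<dots> = (\<Sum>k\<le>n. of_int (S1 n k) * l ^ (n - k) * (deriv ^^ k) f 0)"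
    by (simp add: G_def u_def)
  also have "\<dots> = (\<Sum>k\<le>n. of_int (S1 n k) * l ^ (n - k) * a k)"
    using has_egf_at_0[OF has_egf_deriv_funpow[OF f]] by simp
  finally show ?thesis .
qed

section \<open>Bell polynomials and the final identity\<close>

lemma bell_Suc: "bell (Suc n) x = x * (\<Sum>j\<le>n. of_nat (n choose j) * bell j x)"
proof -
  let ?f = "\<lambda>t. exp (x * (exp t - 1))"
  have "has_egf (\<lambda>n. bell (Suc n) x) (\<lambda>t. x * (?f t * exp t))"
    by (rule has_egf_derivative[OF has_egf_bell])
      (auto intro!: derivative_eq_intros always_eventually)
  \<comment> \<open>The trailing 1 is the coefficient of \<open>exp\<close>; uniqueness then equates
    both expansions of the derivative.\<close>
  moreover have "has_egf (\<lambda>n. x * (\<Sum>j\<le>n. of_nat (n choose j) * bell j x * 1)) (\<lambda>t. x * (?f t * exp t))"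
    by (intro has_egf_cmult has_egf_mult has_egf_bell has_egf_exp)
  ultimately have "(\<lambda>n. bell (Suc n) x) = (\<lambda>n. x * (\<Sum>j\<le>n. of_nat (n choose j) * bell j x * 1))"
    by (rule has_egf_unique)
  then show ?thesis by (simp add: fun_eq_iff)
qed

text \<open>Since \<open>1 + lam\<close> and, near 0, \<open>1 + lam * t\<close> are positive, both
  powers are exponentials of logarithms, and \<open>ln (1 + lam)\<close> merges with
  \<open>x / lam\<close> into the argument of \<open>bell\<close>.\<close>

lemma degenerate_bell_eq_sum_bell:
  assumes "lam > -1" "lam \<noteq> 0"
  shows "degenerate_bell n lam x =
    (\<Sum>k\<le>n. of_int (S1 n k) * lam ^ (n - k) * bell k (x * (ln (1 + lam) / lam)))"
proof (rule has_egf_compose_ln[OF has_egf_bell _ assms(2)])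
  have "\<forall>\<^sub>F t in nhds 0. 1 + lam * t > 0"
    by (rule order_tendstoD[of _ 1]) (auto intro!: tendsto_eq_intros filterlim_ident)
  then have "\<forall>\<^sub>F t in nhds 0. (1 + lam) powr (x / lam * ((1 + lam * t) powr (1 / lam) - 1))
      = exp (x * (ln (1 + lam) / lam) * (exp (ln (1 + lam * t) / lam) - 1))"
    by eventually_elim (use assms in \<open>simp add: powr_def mult_ac\<close>)
  from has_egf_cong[OF this] has_egf_degenerate_bell[OF assms]
  show "has_egf (\<lambda>n. degenerate_bell n lam x)
      (\<lambda>t. exp (x * (ln (1 + lam) / lam) * (exp (ln (1 + lam * t) / lam) - 1)))"
    by blast
qed

theorem theorem7:
  fixes lam x :: real and n :: nat
  assumes "lam > -1" and "lam \<noteq> 0" and "n \<ge> 1"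
  shows "degenerate_bell n lam x =
    ln (1 + lam) / lam * x *
    (\<Sum>k=1..n. \<Sum>j=1..k.
       of_int (S1 n k) * lam ^ (n - k) * of_nat ((k - 1) choose (j - 1)) *
       bell (j - 1) (x * (ln (1 + lam) / lam)))"
proof -
  let ?c = "x * (ln (1 + lam) / lam)"
  have bell: "bell k ?c = ?c * (\<Sum>j=1..k. of_nat ((k - 1) choose (j - 1)) * bell (j - 1) ?c)"
    if "k \<ge> 1" for k
  proof -
    obtain m where m: "k = Suc m"
      using \<open>k \<ge> 1\<close> by (cases k) simp_all
    show ?thesis
      unfolding m One_nat_def sum.shift_bounds_cl_Suc_ivl diff_Suc_Suc diff_zero
      by (simp add: bell_Suc atMost_atLeast0)
  qed
  have "degenerate_bell n lam x = (\<Sum>k\<le>n. of_int (S1 n k) * lam ^ (n - k) * bell k ?c)"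
    by (rule degenerate_bell_eq_sum_bell) fact+
  \<comment> \<open>Here \<open>n \<ge> 1\<close> enters: it makes \<open>S1 n 0\<close> vanish. For
    \<open>n = 0\<close> the dropped term would be \<open>bell 0 ?c\<close>, which is 1.\<close>
  also have "\<dots> = (\<Sum>k=1..n. of_int (S1 n k) * lam ^ (n - k) * bell k ?c)"
    using assms(3) S1_0_right[of n]
    by (intro sum.mono_neutral_right) (auto simp: not_less_eq_eq)
  also have "\<dots> = (\<Sum>k=1..n. of_int (S1 n k) * lam ^ (n - k) *
      (?c * (\<Sum>j=1..k. of_nat ((k - 1) choose (j - 1)) * bell (j - 1) ?c)))"
    using bell by (intro sum.cong) auto
  finally show ?thesis
    by (simp add: sum_distrib_left mult_ac)
qed

end
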